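(* Let $I$ be a countable index set and, for each $k\ge1$, let $\mathbf X^k=(X^k_i)_{i\in I}$ be a family of random elements of a POP space $(\mathbb X,\preceq)$. Suppose that either every $\mathbf X^k$ is negatively associated or every $\mathbf X^k$ is positively associated, and that $\mathbf X^k\to\mathbf X=(X_i)_{i\in I}$ in distribution as random elements of $\mathbb X^I$ (product topology) as $k\to\infty$. Then $\mathbf X$ is negatively associated in the first case and positively associated in the second case.
   Context: A POP space is a Polish space $\mathbb X$ with a closed partial order $\preceq$ (the set $\{(x,x'):x\preceq x'\}$ is closed in $\mathbb X^2$). For $J\subset I$, $X_J=(X_i)_{i\in J}$ is a random element of $\mathbb X^J$ with product topology, product Borel $\sigma$-field and coordinatewise order; $f$ is non-decreasing if $x\preceq y$ coordinatewise implies $f(x)\le f(y)$. A family $\mathbf X=(X_i)_{i\in I}$ is negatively associated (NA) if $\mathbb E[f(X_J)g(X_{I\setminus J})]\le \mathbb E[f(X_J)]\,\mathbb E[g(X_{I\setminus J})]$ for all $J\subset I$ and all bounded measurable non-decreasing $f:\mathbb X^J\to\mathbb R$, $g:\mathbb X^{I\setminus J}\to\mathbb R$; it is positively associated (PA) if $\mathbb E[f(X_J)g(X_J)]\ge \mathbb E[f(X_J)]\,\mathbb E[g(X_J)]$ for all $J\subset I$ and all bounded measurable non-decreasing $f,g:\mathbb X^J\to\mathbb R$. *)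

theory Defs
  imports "HOL-Analysis.Analysis" "HOL-Probability.Probability"
begin

definition pop_space :: "('a::polish_space \<Rightarrow> 'a \<Rightarrow> bool) \<Rightarrow> bool" where
  "pop_space le \<longleftrightarrow> partial_order_on UNIV {(x, y). le x y} \<and> closed {(x, y). le x y}"

text \<open>X^J with the product Borel sigma-field is modelled as PiM J (\<lambda>_. borel);
  its points are the extensional functions on J.\<close>
definition nondecreasing_on :: "('a \<Rightarrow> 'a \<Rightarrow> bool) \<Rightarrow> 'i set \<Rightarrow> (('i \<Rightarrow> 'a::topological_space) \<Rightarrow> real) \<Rightarrow> bool" where
  "nondecreasing_on le J f \<longleftrightarrow>
     (\<forall>x\<in>space (PiM J (\<lambda>_. borel)). \<forall>y\<in>space (PiM J (\<lambda>_. borel)).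
        (\<forall>i\<in>J. le (x i) (y i)) \<longrightarrow> f x \<le> f y)"

definition test_fun :: "('a \<Rightarrow> 'a \<Rightarrow> bool) \<Rightarrow> 'i set \<Rightarrow> (('i \<Rightarrow> 'a::topological_space) \<Rightarrow> real) \<Rightarrow> bool" where
  "test_fun le J f \<longleftrightarrow>
     f \<in> borel_measurable (PiM J (\<lambda>_. borel)) \<and>
     (\<exists>B. \<forall>x\<in>space (PiM J (\<lambda>_. borel)). \<bar>f x\<bar> \<le> B) \<and>
     nondecreasing_on le J f"

text \<open>A family (X_i)_{i} of random elements on the probability space M is given
  as X :: 'w \<Rightarrow> 'i \<Rightarrow> 'a with X_i \<omega> = X \<omega> i; the subfamily X_J is restrict (X \<omega>) J.\<close>
definition random_element :: "'w measure \<Rightarrow> ('w \<Rightarrow> 'i \<Rightarrow> 'a::topological_space) \<Rightarrow> bool" where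
  "random_element M X \<longleftrightarrow> X \<in> measurable M (PiM UNIV (\<lambda>_. borel))"

definition neg_assoc :: "'w measure \<Rightarrow> ('a \<Rightarrow> 'a \<Rightarrow> bool) \<Rightarrow> ('w \<Rightarrow> 'i \<Rightarrow> 'a::topological_space) \<Rightarrow> bool" where
  "neg_assoc M le X \<longleftrightarrow>
     (\<forall>J f g. test_fun le J f \<and> test_fun le (UNIV - J) g \<longrightarrow>
        (\<integral>\<omega>. f (restrict (X \<omega>) J) * g (restrict (X \<omega>) (UNIV - J)) \<partial>M)
          \<le> (\<integral>\<omega>. f (restrict (X \<omega>) J) \<partial>M) * (\<integral>\<omega>. g (restrict (X \<omega>) (UNIV - J)) \<partial>M))"

definition pos_assoc :: "'w measure \<Rightarrow> ('a \<Rightarrow> 'a \<Rightarrow> bool) \<Rightarrow> ('w \<Rightarrow> 'i \<Rightarrow> 'a::topological_space) \<Rightarrow> bool" where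
  "pos_assoc M le X \<longleftrightarrow>
     (\<forall>J f g. test_fun le J f \<and> test_fun le J g \<longrightarrow>
        (\<integral>\<omega>. f (restrict (X \<omega>) J) * g (restrict (X \<omega>) J) \<partial>M)
          \<ge> (\<integral>\<omega>. f (restrict (X \<omega>) J) \<partial>M) * (\<integral>\<omega>. g (restrict (X \<omega>) J) \<partial>M))"

text \<open>Convergence in distribution of random elements of 'i \<Rightarrow> 'a, with the product
  topology on the function type (HOL-Analysis Function_Topology):
  E h(X^k) \<longrightarrow> E h(X) for every bounded continuous real h.\<close>
definition conv_distr :: "(nat \<Rightarrow> 'w measure) \<Rightarrow> (nat \<Rightarrow> 'w \<Rightarrow> 'i \<Rightarrow> 'a::topological_space)
     \<Rightarrow> 'v measure \<Rightarrow> ('v \<Rightarrow> 'i \<Rightarrow> 'a) \<Rightarrow> bool" where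
  "conv_distr Ms Xs M X \<longleftrightarrow>
     (\<forall>h :: ('i \<Rightarrow> 'a) \<Rightarrow> real. continuous_on UNIV h \<and> bounded (range h) \<longrightarrow>
        (\<lambda>k. \<integral>\<omega>. h (Xs k \<omega>) \<partial>(Ms k)) \<longlonglongrightarrow> (\<integral>\<omega>. h (X \<omega>) \<partial>M))"

end

theory Submission
  imports Defs
begin

text \<open>Continuous non-decreasing functions may be too scarce to determine association, so the
  approximation is done with closed up-sets. All measures are pushed to the Polish space X^I, where
  coordinatewise comparison on J is a closed preorder R and the test functions on X^J are the bounded
  Borel R-monotone functions; by slicing into level sets it suffices to treat indicators of up-sets.
  Given an up-set U, inner regularity yields a compact A inside U, and Le Cam's theorem yields a
  compact K carrying almost all the mass of every approximating law. The R-up-closure of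
  (the 1/n-neighbourhood of A) \<inter> K is a closed up-set, and these decrease to a subset of U. So
  for a suitable n its limit probability is not much larger than that of U, while up to the
  complement of K it contains an open neighbourhood of A. The portmanteau inequalities for this
  closed set and this open set sandwich the approximating probabilities around that of U.\<close>

section \<open>Closed relations and thickenings of compact sets\<close>

text \<open>Compactness turns the witnesses \<open>x n\<close> of the points \<open>y n\<close> into
  a subsequence converging in \<open>K\<close>, and closedness of \<open>R\<close> survives the
  limit of the pairs. It serves both metric thickenings and up-closures.\<close>

lemma closed_Image_compact:
  fixes R :: "('a::metric_space \<times> 'b::metric_space) set"
  assumes "closed R" "compact K"
  shows "closed (R `` K)"
  unfolding closed_sequential_limits
proof (intro allI impI, elim conjE)
  fix y l assume y: "\<forall>n. y n \<in> R `` K" and l: "y \<longlonglongrightarrow> l"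
  from y obtain x where x: "\<And>n. x n \<in> K" "\<And>n. (x n, y n) \<in> R"
    unfolding Image_iff by metis
  obtain x0 r where x0: "x0 \<in> K" and r: "strict_mono (r::nat\<Rightarrow>nat)" and lim: "(x \<circ> r) \<longlonglongrightarrow> x0"
    using \<open>compact K\<close> x(1) unfolding compact_def by metis
  have "(\<lambda>n. ((x \<circ> r) n, (y \<circ> r) n)) \<longlonglongrightarrow> (x0, l)"
    using lim LIMSEQ_subseq_LIMSEQ[OF l r] by (rule tendsto_Pair)
  moreover have "((x \<circ> r) n, (y \<circ> r) n) \<in> R" for n
    using x(2) by simp
  ultimately have "(x0, l) \<in> R"
    by (rule closed_sequentially[OF \<open>closed R\<close>, rotated])
  with x0 show "l \<in> R `` K" by blast
qed

text \<open>The form as a relational image makes closedness for compact \<open>A\<close> an instance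
  of \<open>closed_Image_compact\<close>. It also keeps the thickening of the empty set empty, while
  a bound on \<open>infdist\<close> by some \<open>e \<ge> 0\<close> would admit every point
  there.\<close>

definition thickening :: "real \<Rightarrow> 'a::metric_space set \<Rightarrow> 'a set" where
  "thickening e A = {(x, y). dist x y \<le> e} `` A"

definition open_thickening :: "real \<Rightarrow> 'a::metric_space set \<Rightarrow> 'a set" where
  "open_thickening e A = (\<Union>a\<in>A. ball a e)"

lemma closed_thickening:
  fixes A :: "'a::metric_space set"
  assumes "compact A" shows "closed (thickening e A)"
proof -
  have "closed {(x::'a, y). dist x y \<le> e}"
    unfolding case_prod_unfold by (intro closed_Collect_le continuous_intros)
  then show ?thesis
    unfolding thickening_def using assms by (rule closed_Image_compact)
qed

lemma thickening_mono: "d \<le> e \<Longrightarrow> thickening d A \<subseteq> thickening e A"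
  by (force simp: thickening_def)

lemma open_open_thickening: "open (open_thickening e A)"
  by (auto simp: open_thickening_def)

lemma open_thickening_subset: "open_thickening e A \<subseteq> thickening e A"
  by (force simp: thickening_def open_thickening_def)

lemma subset_open_thickening: "0 < e \<Longrightarrow> A \<subseteq> open_thickening e A"
  by (force simp: open_thickening_def)

section \<open>Weak convergence: inner regularity, portmanteau bounds, tightness\<close>

text \<open>Inner regularity of finite Borel measures on a Polish space, recast with an additive
  error for real-valued measures.\<close>

lemma prob_inner_compact:
  fixes L :: "'a::polish_space measure"
  assumes "prob_space L" "sets L = sets borel" "B \<in> sets borel" "0 < e"
  obtains K where "K \<subseteq> B" "compact K" "measure L B < measure L K + e"
proof -
  interpret prob_space L by fact
  have "emeasure L B = (SUP K \<in> {K. K \<subseteq> B \<and> compact K}. emeasure L K)"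
    by (rule inner_regular) (use assms in auto)
  show ?thesis
  \<comment> \<open>If \<open>measure L B - e\<close> is negative, \<open>ennreal\<close> sends it
    to 0, which need not lie strictly below the supremum; the empty compact set then
    suffices.\<close>
  proof (cases "measure L B < e")
    case True
    then show ?thesis using that[of "{}"] by auto
  next
    case False
    then have "ennreal (measure L B - e) < emeasure L B"
      using assms by (simp add: emeasure_eq_measure ennreal_less_iff)
    also have "\<dots> = (SUP K \<in> {K. K \<subseteq> B \<and> compact K}. emeasure L K)" by fact
    finally obtain K where "K \<subseteq> B" "compact K" "ennreal (measure L B - e) < emeasure L K"
      by (auto simp: less_SUP_iff)
    then show ?thesis using that[of K] False
      by (auto simp: emeasure_eq_measure ennreal_less_iff)
  qed
qed

locale weak_limit =
  fixes N :: "nat \<Rightarrow> 'a::polish_space measure" and L :: "'a measure"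
  assumes prob_N: "\<And>k. prob_space (N k)" and prob_L: "prob_space L"
    and sets_N [simp]: "\<And>k. sets (N k) = sets borel" and sets_L [simp]: "sets L = sets borel"
    and integral_tendsto: "\<And>h::'a \<Rightarrow> real. continuous_on UNIV h \<Longrightarrow> bounded (range h) \<Longrightarrow>
      (\<lambda>k. \<integral>x. h x \<partial>N k) \<longlonglongrightarrow> (\<integral>x. h x \<partial>L)"
begin

lemma spaces [simp]: "space (N k) = UNIV" "space L = UNIV"
  using sets_eq_imp_space_eq[OF sets_N] sets_eq_imp_space_eq[OF sets_L] by auto

text \<open>The closed half of the portmanteau theorem. The bounded continuous functions
  \<open>h n\<close> dominate the indicator of \<open>F\<close> and converge to it pointwise, since
  a point off a closed set has positive distance from it. One \<open>n\<close> is fixed by the limit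
  law before \<open>k\<close> varies.\<close>

lemma eventually_closed_less:
  assumes "closed F" "0 < e"
  shows "\<forall>\<^sub>F k in sequentially. measure (N k) F < measure L F + e"
\<comment> \<open>\<open>infdist x {}\<close> is 0, so for empty \<open>F\<close> every
  \<open>h n\<close> would be constantly 1.\<close>
proof (cases "F = {}")
  case True
  then show ?thesis using assms by simp
next
  case False
  interpret L: prob_space L by (rule prob_L)
  define h where "h n x = max 0 (1 - real n * infdist x F)" for n x
  have F: "F \<in> sets borel" using \<open>closed F\<close> by simp
  have cont: "continuous_on UNIV (h n)" for n
    unfolding h_def by (intro continuous_intros)
  have meas: "h n \<in> borel_measurable borel" for n
    using cont by (rule borel_measurable_continuous_onI)
  have h01: "0 \<le> h n x" "h n x \<le> 1" for n x
    by (auto simp: h_def infdist_nonneg)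
  have bdd: "bounded (range (h n))" for n
    using h01 by (auto intro!: boundedI[where B=1])
  have "(\<lambda>n. h n x) \<longlonglongrightarrow> indicator F x" for x
  proof (cases "x \<in> F")
    case True
    then show ?thesis by (simp add: h_def)
  next
    case False
    with \<open>F \<noteq> {}\<close> \<open>closed F\<close> have pos: "0 < infdist x F"
      by (simp add: infdist_pos_not_in_closed)
    obtain m where m: "1 < real m * infdist x F"
      using pos reals_Archimedean3 by blast
    have "h n x = 0" if "m \<le> n" for n
    proof -
      have "real m * infdist x F \<le> real n * infdist x F"
        using that pos by simp
      with m show ?thesis by (simp add: h_def)
    qed
    then show ?thesis using False
      by (intro tendsto_eventually) (auto simp: eventually_sequentially)
  qed
  then have "(\<lambda>n. \<integral>x. h n x \<partial>L) \<longlonglongrightarrow> (\<integral>x. indicator F x \<partial>L)"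
    by (intro integral_dominated_convergence[where w="\<lambda>_. 1"])
      (use F meas h01 in \<open>auto simp: measurable_cong_sets[OF sets_L refl]\<close>)
  then have "(\<lambda>n. \<integral>x. h n x \<partial>L) \<longlonglongrightarrow> measure L F"
    using F by simp
  then have "\<forall>\<^sub>F n in sequentially. (\<integral>x. h n x \<partial>L) < measure L F + e"
    using \<open>0 < e\<close> by (intro order_tendstoD) auto
  then obtain n where "(\<integral>x. h n x \<partial>L) < measure L F + e"
    by (auto dest: eventually_happens)
  then have "\<forall>\<^sub>F k in sequentially. (\<integral>x. h n x \<partial>N k) < measure L F + e"
    using integral_tendsto[OF cont bdd] by (rule order_tendstoD(2)[rotated])
  then show ?thesis
  proof eventually_elim
    case (elim k)
    interpret N: prob_space "N k" by (rule prob_N)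
    have "measure (N k) F = (\<integral>x. indicator F x \<partial>N k)" using F by simp
    also have "\<dots> \<le> (\<integral>x. h n x \<partial>N k)"
    proof (rule integral_mono)
      show "integrable (N k) (h n)"
        by (rule N.integrable_const_bound[where B=1])
          (use h01 meas in \<open>auto simp: measurable_cong_sets[OF sets_N refl]\<close>)
      show "integrable (N k) (indicator F :: 'a \<Rightarrow> real)"
        using F by (simp add: N.emeasure_eq_measure)
      show "indicator F x \<le> h n x" for x
        using h01[of n x] by (auto simp: h_def indicator_def)
    qed
    finally show ?case using elim by simp
  qed
qed

text \<open>The open half of the portmanteau theorem, by passing to complements.\<close>

lemma eventually_open_greater:
  assumes "open O'" "0 < e"
  shows "\<forall>\<^sub>F k in sequentially. measure L O' < measure (N k) O' + e"
proof -
  interpret L: prob_space L by (rule prob_L)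
  have O': "O' \<in> sets borel" using \<open>open O'\<close> by simp
  have "\<forall>\<^sub>F k in sequentially. measure (N k) (- O') < measure L (- O') + e"
    using assms by (intro eventually_closed_less) auto
  then show ?thesis
  proof eventually_elim
    case (elim k)
    interpret N: prob_space "N k" by (rule prob_N)
    show ?case
      using elim N.prob_compl[of O'] L.prob_compl[of O'] O' by (simp add: Compl_eq_Diff_UNIV)
  qed
qed

text \<open>A compact \<open>A\<close> nearly full for \<open>L\<close> has an open thickening that
  is nearly full for all \<open>N k\<close> with \<open>k \<ge> m\<close>. The finitely many earlier
  laws each contribute a compact set of their own, and the finite union stays compact.\<close>

lemma uniformly_thick_compact:
  assumes "0 < e" "0 < d"
  obtains K where "compact K" "\<And>k. measure (N k) (- thickening d K) < e"
proof -
  interpret L: prob_space L by (rule prob_L)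
  obtain A where A: "compact A" "measure L UNIV < measure L A + e/2"
    using prob_inner_compact[OF prob_L sets_L, of UNIV "e/2"] \<open>0 < e\<close> by auto
  obtain m where m: "measure L (open_thickening d A) < measure (N k) (open_thickening d A) + e/2"
    if "k \<ge> m" for k
    using eventually_open_greater[OF open_open_thickening, of "e/2" d A] \<open>0 < e\<close>
    unfolding eventually_sequentially by auto
  have "\<exists>C. compact C \<and> measure (N k) UNIV < measure (N k) C + e" for k
    using prob_inner_compact[OF prob_N sets_N, of UNIV e k] \<open>0 < e\<close> by auto
  then obtain C where C: "\<And>k. compact (C k)" "\<And>k. measure (N k) UNIV < measure (N k) (C k) + e"
    by metis
  define K where "K = A \<union> (\<Union>k<m. C k)"
  have "compact K"
    unfolding K_def using A C by (intro compact_Un compact_UN) auto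
  moreover have "measure (N k) (- thickening d K) < e" for k
  proof -
    interpret N: prob_space "N k" by (rule prob_N)
    have T: "thickening d K \<in> sets borel"
      using closed_thickening[OF \<open>compact K\<close>] by simp
    have "1 < measure (N k) (thickening d K) + e"
    proof (cases "k < m")
      case True
      then have "C k \<subseteq> K" by (auto simp: K_def)
      then have "C k \<subseteq> thickening d K"
        using subset_open_thickening[OF \<open>0 < d\<close>, of K] open_thickening_subset[of d K] by blast
      then have "measure (N k) (C k) \<le> measure (N k) (thickening d K)"
        using T by (intro N.finite_measure_mono) auto
      then show ?thesis using C(2)[of k] N.prob_space by simp
    next
      case False
      have "measure L A \<le> measure L (open_thickening d A)"
        using subset_open_thickening[OF \<open>0 < d\<close>, of A] open_open_thickening[of d A]
        by (intro L.finite_measure_mono) auto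
      also have "\<dots> < measure (N k) (open_thickening d A) + e/2"
        using m False by simp
      also have "measure (N k) (open_thickening d A) \<le> measure (N k) (thickening d K)"
      proof (rule N.finite_measure_mono)
        show "open_thickening d A \<subseteq> thickening d K"
          using open_thickening_subset[of d A] by (auto simp: thickening_def K_def)
      qed (use T in auto)
      finally show ?thesis using A(2) L.prob_space by simp
    qed
    then show ?thesis
      using N.prob_compl[of "thickening d K"] T by (simp add: Compl_eq_Diff_UNIV)
  qed
  ultimately show ?thesis using that by blast
qed

text \<open>Le Cam's theorem. A thickening of a compact set need not be compact, but an intersection
  of thickenings with radii tending to 0 is closed and totally bounded, hence compact in a complete
  space. Geometrically decreasing errors keep the total loss under control.\<close>

lemma uniformly_tight:
  assumes "0 < e"
  obtains K where "compact K" "\<And>k. measure (N k) (- K) \<le> e"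
proof -
  \<comment> \<open>The exponent \<open>Suc m\<close> makes the errors add up to exactly
    \<open>e\<close>.\<close>
  define w where "w = (\<lambda>m. e * (1/2) ^ Suc m)"
  have w: "w sums e"
    using sums_mult[OF power_half_series, of e] unfolding w_def mult_1_right .
  have "\<exists>K. compact K \<and> (\<forall>k. measure (N k) (- thickening (1 / Suc m) K) < w m)" for m
  proof -
    have "0 < w m" "0 < 1 / real (Suc m)" using assms by (auto simp: w_def)
    from uniformly_thick_compact[OF this] show ?thesis by metis
  qed
  then obtain C where C: "\<And>m. compact (C m)"
    "\<And>m k. measure (N k) (- thickening (1 / Suc m) (C m)) < w m"
    by metis
  define K where "K = (\<Inter>m. thickening (1 / Suc m) (C m))"
  have "closed K" unfolding K_def using C closed_thickening by blast
  have "compact K"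
    unfolding compact_eq_totally_bounded complete_eq_closed
  proof (intro conjI allI impI)
    show "closed K" by fact
    fix d :: real assume "0 < d"
    obtain m where m: "1 / real (Suc m) < d / 2"
      using reals_Archimedean[of "d/2"] \<open>0 < d\<close> by (auto simp: inverse_eq_divide)
    \<comment> \<open>Here \<open>k\<close> is a finite set of centres. A \<open>d/2\<close>-net of
      \<open>C m\<close> is a \<open>d\<close>-net of the thickening of radius
      \<open>1 / Suc m < d / 2\<close>, and so of \<open>K\<close>.\<close>
    obtain k where k: "finite k" "C m \<subseteq> (\<Union>x\<in>k. ball x (d/2))"
      using C(1)[of m] \<open>0 < d\<close> unfolding compact_eq_totally_bounded by (meson half_gt_zero)
    have "K \<subseteq> (\<Union>x\<in>k. ball x d)"
    proof
      fix y assume "y \<in> K"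
      then have "y \<in> thickening (1 / Suc m) (C m)" by (auto simp: K_def)
      then obtain a where "a \<in> C m" "dist a y \<le> 1 / Suc m"
        by (auto simp: thickening_def)
      moreover then obtain x where "x \<in> k" "dist x a < d/2" using k by force
      ultimately have "dist x y < d" using m dist_triangle[of x y a] by linarith
      with \<open>x \<in> k\<close> show "y \<in> (\<Union>x\<in>k. ball x d)" by auto
    qed
    with k(1) show "\<exists>k. finite k \<and> K \<subseteq> (\<Union>x\<in>k. ball x d)" by blast
  qed
  moreover have "measure (N k) (- K) \<le> e" for k
  proof -
    interpret N: prob_space "N k" by (rule prob_N)
    have "closed (thickening (1 / Suc m) (C m))" for m using closed_thickening C by blast
    then have meas: "range (\<lambda>m. - thickening (1 / Suc m) (C m)) \<subseteq> sets (N k)"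
      by auto
    have le: "measure (N k) (- thickening (1 / Suc m) (C m)) \<le> w m" for m
      using C(2)[of k m] by simp
    have sm: "summable (\<lambda>m. measure (N k) (- thickening (1 / Suc m) (C m)))"
      by (rule summable_comparison_test[OF _ sums_summable[OF w]]) (use le in auto)
    have "- K = (\<Union>m. - thickening (1 / Suc m) (C m))" by (auto simp: K_def)
    then have "measure (N k) (- K) \<le> (\<Sum>m. measure (N k) (- thickening (1 / Suc m) (C m)))"
      using N.finite_measure_subadditive_countably[OF meas sm] by simp
    also have "\<dots> \<le> suminf w"
      by (rule suminf_le[OF le sm sums_summable[OF w]])
    also have "\<dots> = e" using w by (simp add: sums_iff)
    finally show ?thesis .
  qed
  ultimately show ?thesis using that by blast
qed

end

section \<open>Approximation by closed up-sets and the covariance sign for up-sets\<close>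

text \<open>For fixed \<open>y\<close> there are \<open>a n\<close> in \<open>A\<close> and
  \<open>x n\<close> in \<open>K\<close> below \<open>y\<close> at distance tending to 0. The cut by
  \<open>K\<close> yields a convergent subsequence of the \<open>x n\<close>; the \<open>a n\<close>
  follow it to the same limit, which lies in \<open>A\<close> and is still related to
  \<open>y\<close>.\<close>

lemma INT_Image_thickening_subset:
  fixes A K :: "'a::metric_space set" and R :: "('a \<times> 'a) set"
  assumes "closed R" "compact A" "compact K"
  shows "(\<Inter>n. R `` (thickening (1 / Suc n) A \<inter> K)) \<subseteq> R `` A"
proof
  fix y assume "y \<in> (\<Inter>n. R `` (thickening (1 / Suc n) A \<inter> K))"
  then have "y \<in> R `` (thickening (1 / Suc n) A \<inter> K)" for n by blast
  then have "\<exists>a x. a \<in> A \<and> x \<in> K \<and> dist a x \<le> 1 / Suc n \<and> (x, y) \<in> R" for n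
    unfolding thickening_def by blast
  then obtain a x where ax: "\<And>n. a n \<in> A" "\<And>n. x n \<in> K" "\<And>n. (x n, y) \<in> R"
    "\<And>n. dist (a n) (x n) \<le> 1 / Suc n"
    by metis
  obtain z r where r: "strict_mono (r::nat\<Rightarrow>nat)" and z: "(x \<circ> r) \<longlonglongrightarrow> z"
    using \<open>compact K\<close> ax(2) unfolding compact_def by metis
  have "(z, y) \<in> R"
  proof (rule closed_sequentially[OF \<open>closed R\<close>])
    show "((x \<circ> r) n, y) \<in> R" for n using ax(3) by simp
    show "(\<lambda>n. ((x \<circ> r) n, y)) \<longlonglongrightarrow> (z, y)"
      by (intro tendsto_Pair z tendsto_const)
  qed
  moreover have "z \<in> A"
  proof (rule closed_sequentially[OF compact_imp_closed[OF \<open>compact A\<close>]])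
    show "(a \<circ> r) n \<in> A" for n using ax(1) by simp
    have "(\<lambda>n. 1 / real (Suc n)) \<longlonglongrightarrow> 0" by (rule LIMSEQ_Suc) (rule lim_1_over_n)
    then have "(\<lambda>n. 1 / real (Suc (r n))) \<longlonglongrightarrow> 0"
      using LIMSEQ_subseq_LIMSEQ[OF _ r] unfolding o_def by blast
    moreover have "(\<lambda>n. dist ((x \<circ> r) n) z) \<longlonglongrightarrow> 0"
      using z by (rule tendsto_dist_iff[THEN iffD1])
    ultimately have "(\<lambda>n. 1 / real (Suc (r n)) + dist ((x \<circ> r) n) z) \<longlonglongrightarrow> 0 + 0"
      by (rule tendsto_add)
    then have lim: "(\<lambda>n. 1 / real (Suc (r n)) + dist ((x \<circ> r) n) z) \<longlonglongrightarrow> 0" by simp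
    have "dist ((a \<circ> r) n) z \<le> 1 / real (Suc (r n)) + dist ((x \<circ> r) n) z" for n
      using dist_triangle[of "a (r n)" z "x (r n)"] ax(4)[of "r n"] by simp
    then have "(\<lambda>n. dist ((a \<circ> r) n) z) \<longlonglongrightarrow> 0"
      by (intro tendsto_sandwich[OF _ _ tendsto_const lim]) auto
    then show "(a \<circ> r) \<longlonglongrightarrow> z" by (rule tendsto_dist_iff[THEN iffD2])
  qed
  ultimately show "y \<in> R `` A" by blast
qed

lemma abs_mult_diff_le_unit:
  fixes p q p' q' :: real
  assumes "\<bar>p\<bar> \<le> 1" "\<bar>q'\<bar> \<le> 1"
  shows "\<bar>p' * q' - p * q\<bar> \<le> \<bar>p' - p\<bar> + \<bar>q' - q\<bar>"
proof -
  have "p' * q' - p * q = (p' - p) * q' + p * (q' - q)" by (simp add: algebra_simps)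
  also have "\<bar>\<dots>\<bar> \<le> \<bar>p' - p\<bar> * \<bar>q'\<bar> + \<bar>p\<bar> * \<bar>q' - q\<bar>"
    by (metis abs_mult abs_triangle_ineq)
  also have "\<dots> \<le> \<bar>p' - p\<bar> * 1 + 1 * \<bar>q' - q\<bar>"
    using assms by (intro add_mono mult_mono) auto
  finally show ?thesis by simp
qed

context weak_limit
begin

text \<open>The upper bound comes from the closed set \<open>F\<close>. The lower bound comes from
  \<open>W\<close>, which is contained in \<open>F \<union> - K\<close>: it loses
  \<open>2 * e\<close> under \<open>L\<close>, \<open>e\<close> in the passage to
  \<open>N k\<close>, and \<open>e\<close> for the complement of \<open>K\<close>.\<close>

lemma eventually_measure_close:
  assumes "0 < e" and F: "closed F" "measure L F \<le> u + e"
    and W: "open W" "u - 2 * e \<le> measure L W" "W \<inter> K \<subseteq> F"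
    and K: "compact K" "\<And>k. measure (N k) (- K) \<le> e"
  shows "\<forall>\<^sub>F k in sequentially. \<bar>measure (N k) F - u\<bar> \<le> 4 * e"
  using eventually_closed_less[OF F(1) \<open>0 < e\<close>] eventually_open_greater[OF W(1) \<open>0 < e\<close>]
proof eventually_elim
  case (elim k)
  interpret N: prob_space "N k" by (rule prob_N)
  have "closed K" using K(1) by (rule compact_imp_closed)
  have "measure (N k) W \<le> measure (N k) (F \<union> - K)"
    using W F \<open>closed K\<close> by (intro N.finite_measure_mono) auto
  also have "\<dots> \<le> measure (N k) F + measure (N k) (- K)"
    using F \<open>closed K\<close> by (intro measure_Un_le) auto
  finally show ?case using elim K(2)[of k] F(2) W(2) by linarith
qed

text \<open>The sign \<open>s\<close> covers negative and positive association at once. Two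
  relations are allowed because in the negative case the two functions look at different sets of
  coordinates.\<close>

theorem covariance_sign_upsets:
  assumes R: "closed R" "refl R" "trans R" and S: "closed S" "refl S" "trans S"
    and s: "\<bar>s\<bar> = 1"
    and hyp: "\<And>k F G. closed F \<Longrightarrow> R `` F \<subseteq> F \<Longrightarrow> closed G \<Longrightarrow> S `` G \<subseteq> G \<Longrightarrow>
      0 \<le> s * (measure (N k) (F \<inter> G) - measure (N k) F * measure (N k) G)"
    and U: "U \<in> sets borel" "R `` U \<subseteq> U" and V: "V \<in> sets borel" "S `` V \<subseteq> V"
  shows "0 \<le> s * (measure L (U \<inter> V) - measure L U * measure L V)"
proof (rule field_le_epsilon)
  fix d :: real assume "0 < d"
  \<comment> \<open>The joint probability will be off by at most \<open>4 * e\<close> and the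
    product of the marginals by at most \<open>8 * e\<close>.\<close>
  define e where "e = d / 12"
  have "0 < e" using \<open>0 < d\<close> by (simp add: e_def)
  interpret L: prob_space L by (rule prob_L)
  obtain K where K: "compact K" "\<And>k. measure (N k) (- K) \<le> e"
    using uniformly_tight[OF \<open>0 < e\<close>] by blast
  obtain A where A: "A \<subseteq> U" "compact A" "measure L U < measure L A + e"
    using prob_inner_compact[OF prob_L sets_L U(1) \<open>0 < e\<close>] by blast
  obtain B where B: "B \<subseteq> V" "compact B" "measure L V < measure L B + e"
    using prob_inner_compact[OF prob_L sets_L V(1) \<open>0 < e\<close>] by blast
  \<comment> \<open>Cutting by \<open>K\<close> leaves a compact set, so its image under
    \<open>R\<close> is closed; transitivity makes it an up-set. The same \<open>K\<close> serves
    \<open>A\<close> and \<open>B\<close>.\<close>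
  define F where "F n = R `` (thickening (1 / Suc n) A \<inter> K)" for n
  define G where "G n = S `` (thickening (1 / Suc n) B \<inter> K)" for n
  have F: "closed (F n)" and G: "closed (G n)" for n
    unfolding F_def G_def
    by (intro closed_Image_compact R(1) S(1) closed_Int_compact closed_thickening A(2) B(2) K(1))+
  have upF: "R `` F n \<subseteq> F n" and upG: "S `` G n \<subseteq> G n" for n
    unfolding F_def G_def using transD[OF R(3)] transD[OF S(3)] by blast+
  have "thickening (1 / Suc n) C \<subseteq> thickening (1 / Suc m) C" if "m \<le> n" for m n and C :: "'a set"
    using that by (intro thickening_mono) (simp add: frac_le)
  then have dec: "decseq F" "decseq G"
    unfolding F_def G_def decseq_def by (intro allI impI Image_mono Int_mono order_refl; assumption)+
  have "R `` A \<subseteq> U" "S `` B \<subseteq> V"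
    using A(1) B(1) U(2) V(2) by blast+
  then have INT: "(\<Inter>n. F n) \<subseteq> U" "(\<Inter>n. G n) \<subseteq> V"
    using INT_Image_thickening_subset[OF R(1) A(2) K(1), folded F_def]
      INT_Image_thickening_subset[OF S(1) B(2) K(1), folded G_def]
    by (simp_all only: order_trans)
  then have INT': "(\<Inter>n. F n \<inter> G n) \<subseteq> U \<inter> V" by (simp add: INT_Int_distrib le_infI1 le_infI2)
  have dec': "decseq (\<lambda>n. F n \<inter> G n)"
    using dec unfolding decseq_def by (meson Int_mono)
  \<comment> \<open>Continuity from above, applied to \<open>F\<close>, to \<open>G\<close> and to
    their intersections, so that a single \<open>n\<close> works for all three.\<close>
  have "\<forall>\<^sub>F n in sequentially. measure L (C n) < measure L W + e"
    if "\<And>n. closed (C n)" "decseq C" "W \<in> sets borel" "(\<Inter>n. C n) \<subseteq> W" for C W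
  proof (rule order_tendstoD(2))
    show "(\<lambda>n. measure L (C n)) \<longlonglongrightarrow> measure L (\<Inter>n. C n)"
      using that by (intro L.finite_Lim_measure_decseq) auto
    have "measure L (\<Inter>n. C n) \<le> measure L W"
      using that by (intro L.finite_measure_mono) auto
    with \<open>0 < e\<close> show "measure L (\<Inter>n. C n) < measure L W + e" by linarith
  qed
  note ev = this[OF F dec(1) U(1) INT(1)] this[OF G dec(2) V(1) INT(2)]
    this[OF closed_Int[OF F G] dec' sets.Int[OF U(1) V(1)] INT']
  from ev have "\<forall>\<^sub>F n in sequentially. measure L (F n) < measure L U + e \<and>
      measure L (G n) < measure L V + e \<and> measure L (F n \<inter> G n) < measure L (U \<inter> V) + e"
    by eventually_elim simp
  then obtain n where n: "measure L (F n) < measure L U + e" "measure L (G n) < measure L V + e"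
    "measure L (F n \<inter> G n) < measure L (U \<inter> V) + e"
    using eventually_happens'[OF sequentially_bot] by blast
  define P where "P = open_thickening (1 / Suc n) A"
  define Q where "Q = open_thickening (1 / Suc n) B"
  have PQ: "open P" "open Q" "A \<subseteq> P" "B \<subseteq> Q"
    unfolding P_def Q_def by (simp_all add: open_open_thickening subset_open_thickening)
  \<comment> \<open>Reflexivity places the thickened set, cut by \<open>K\<close>, inside its own
    up-closure.\<close>
  have PF: "P \<inter> K \<subseteq> F n" "Q \<inter> K \<subseteq> G n"
    using open_thickening_subset[of "1 / Suc n" A] open_thickening_subset[of "1 / Suc n" B]
      refl_onD[OF R(2)] refl_onD[OF S(2)]
    unfolding P_def Q_def F_def G_def by blast+
  have [simp]: "A \<in> sets borel" "B \<in> sets borel" "P \<in> sets borel" "Q \<in> sets borel"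
    "U \<in> sets borel" "V \<in> sets borel"
    using A(2) B(2) PQ U(1) V(1) by (simp_all add: borel_compact)
  have lowP: "measure L U - e \<le> measure L P" "measure L V - e \<le> measure L Q"
    using L.finite_measure_mono[OF PQ(3)] L.finite_measure_mono[OF PQ(4)] A(3) B(3) by simp_all
  \<comment> \<open>A point of \<open>U \<inter> V\<close> outside \<open>P \<inter> Q\<close>
    misses \<open>A\<close> or \<open>B\<close>. Two such losses explain the slack
    \<open>2 * e\<close> in \<open>eventually_measure_close\<close>.\<close>
  have "measure L (U \<inter> V) \<le> measure L ((P \<inter> Q) \<union> ((U - A) \<union> (V - B)))"
    using PQ(3,4) by (intro L.finite_measure_mono) (auto intro!: sets.Un sets.Int sets.Diff)
  also have "\<dots> \<le> measure L (P \<inter> Q) + measure L ((U - A) \<union> (V - B))"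
    by (intro measure_Un_le) (auto intro!: sets.Un sets.Int sets.Diff)
  also have "measure L ((U - A) \<union> (V - B)) \<le> measure L (U - A) + measure L (V - B)"
    by (intro measure_Un_le) (auto intro!: sets.Un sets.Int sets.Diff)
  also have "measure L (U - A) = measure L U - measure L A"
    using A(1) by (intro L.finite_measure_Diff) auto
  also have "measure L (V - B) = measure L V - measure L B"
    using B(1) by (intro L.finite_measure_Diff) auto
  finally have lowPQ: "measure L (U \<inter> V) - 2 * e \<le> measure L (P \<inter> Q)"
    using A(3) B(3) by simp
  have "\<forall>\<^sub>F k in sequentially. \<bar>measure (N k) (F n) - measure L U\<bar> \<le> 4 * e"
    using \<open>0 < e\<close> F PQ n(1) lowP(1) PF(1) K by (intro eventually_measure_close[where W=P and K=K]) auto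
  moreover have "\<forall>\<^sub>F k in sequentially. \<bar>measure (N k) (G n) - measure L V\<bar> \<le> 4 * e"
    using \<open>0 < e\<close> G PQ n(2) lowP(2) PF(2) K by (intro eventually_measure_close[where W=Q and K=K]) auto
  moreover have "\<forall>\<^sub>F k in sequentially. \<bar>measure (N k) (F n \<inter> G n) - measure L (U \<inter> V)\<bar> \<le> 4 * e"
    using \<open>0 < e\<close> F G PQ n(3) lowPQ PF K
    by (intro eventually_measure_close[where W="P \<inter> Q" and K=K]) auto
  ultimately have "\<forall>\<^sub>F k in sequentially. \<bar>measure (N k) (F n) - measure L U\<bar> \<le> 4 * e \<and>
      \<bar>measure (N k) (G n) - measure L V\<bar> \<le> 4 * e \<and>
      \<bar>measure (N k) (F n \<inter> G n) - measure L (U \<inter> V)\<bar> \<le> 4 * e"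
    by eventually_elim simp
  then obtain k where k: "\<bar>measure (N k) (F n) - measure L U\<bar> \<le> 4 * e"
      "\<bar>measure (N k) (G n) - measure L V\<bar> \<le> 4 * e"
      "\<bar>measure (N k) (F n \<inter> G n) - measure L (U \<inter> V)\<bar> \<le> 4 * e"
    using eventually_happens'[OF sequentially_bot] by blast
  interpret N: prob_space "N k" by (rule prob_N)
  have "\<bar>measure (N k) (F n) * measure (N k) (G n) - measure L U * measure L V\<bar> \<le> 8 * e"
    using abs_mult_diff_le_unit[of "measure L U" "measure (N k) (G n)"
        "measure (N k) (F n)" "measure L V"] k by simp
  \<comment> \<open>With the sign fixed, the final estimate is linear in the measures and their
    products.\<close>
  moreover have "s = 1 \<or> s = - 1" using s by linarith
  moreover have "0 \<le> s * (measure (N k) (F n \<inter> G n) - measure (N k) (F n) * measure (N k) (G n))"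
    by (rule hyp[OF F upF G upG])
  moreover have "d = 12 * e" by (simp add: e_def)
  ultimately show "0 \<le> s * (measure L (U \<inter> V) - measure L U * measure L V) + d"
    using k(3) by (elim disjE) (simp_all add: abs_le_iff)
qed

end

section \<open>From level sets to bounded functions\<close>

text \<open>The positive integers up to \<open>y\<close> are those from 1 to
  \<open>\<lfloor>y\<rfloor>\<close>, and \<open>y \<le> real n\<close> ensures that the cut at
  \<open>n\<close> drops none of them.\<close>

lemma sum_of_bool_le_eq_floor:
  fixes y :: real
  assumes "0 \<le> y" "y \<le> real n"
  shows "(\<Sum>j=1..n. of_bool (real j \<le> y)) = real_of_int \<lfloor>y\<rfloor>"
proof -
  have "nat \<lfloor>y\<rfloor> \<le> n" using assms by linarith
  then have "{j\<in>{1..n}. real j \<le> y} = {1..nat \<lfloor>y\<rfloor>}"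
    using assms by (auto simp: le_nat_iff le_floor_iff)
  moreover have "(\<Sum>j=1..n. of_bool (real j \<le> y)) = real (card {j\<in>{1..n}. real j \<le> y})"
    by (simp add: Int_def)
  ultimately show ?thesis using assms by simp
qed

lemma floor_scale_tendsto:
  fixes y :: real
  shows "(\<lambda>n. real_of_int \<lfloor>real n * y\<rfloor> / real n) \<longlonglongrightarrow> y"
proof (rule real_tendsto_sandwich)
  have "(\<lambda>n. y - 1 / real n) \<longlonglongrightarrow> y - 0"
    by (intro tendsto_diff tendsto_const lim_1_over_n)
  then show "(\<lambda>n. y - 1 / real n) \<longlonglongrightarrow> y" by simp
  show "(\<lambda>n. y) \<longlonglongrightarrow> y" by simp
  show "\<forall>\<^sub>F n in sequentially. y - 1 / real n \<le> real_of_int \<lfloor>real n * y\<rfloor> / real n"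
    using eventually_gt_at_top[of 0]
  proof eventually_elim
    case (elim n)
    have "real n * y - 1 \<le> real_of_int \<lfloor>real n * y\<rfloor>" by linarith
    then have "(real n * y - 1) / real n \<le> real_of_int \<lfloor>real n * y\<rfloor> / real n"
      by (intro divide_right_mono) auto
    with elim show ?case by (simp add: diff_divide_distrib)
  qed
  show "\<forall>\<^sub>F n in sequentially. real_of_int \<lfloor>real n * y\<rfloor> / real n \<le> y"
    using eventually_gt_at_top[of 0]
    by eventually_elim (simp add: divide_le_eq mult.commute)
qed

text \<open>After scaling by \<open>n\<close> the thresholds become integers, so the indicators
  count the integers passed by \<open>real n * h x\<close>. With \<open>floor_scale_tendsto\<close>
  this gives pointwise convergence of the level-set averages.\<close>

lemma step_function_eq_floor:
  fixes h :: "'a \<Rightarrow> real"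
  assumes "x \<in> S" "0 \<le> h x" "h x \<le> 1"
  shows "(\<Sum>j=1..n. indicator {x\<in>S. real j / real n \<le> h x} x) / real n =
    real_of_int \<lfloor>real n * h x\<rfloor> / real n"
\<comment> \<open>For \<open>n = 0\<close> both sides are quotients by 0, hence 0.\<close>
proof (cases "n = 0")
  case False
  have "(\<Sum>j=1..n. indicator {x\<in>S. real j / real n \<le> h x} x) =
      (\<Sum>j=1..n. of_bool (real j \<le> real n * h x) :: real)"
    using assms(1) False by (intro sum.cong) (auto simp: divide_le_eq mult.commute)
  also have "\<dots> = real_of_int \<lfloor>real n * h x\<rfloor>"
    using assms by (intro sum_of_bool_le_eq_floor) (auto simp: mult_left_le)
  finally show ?thesis by simp
qed simp

context prob_space
begin

text \<open>Covariance is bilinear, so its sign passes from indicators of level sets to their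
  averages \<open>F n\<close> and \<open>G n\<close>, and by dominated convergence to
  \<open>f\<close> and \<open>g\<close>.\<close>

lemma covariance_sign_unit:
  assumes f[measurable]: "f \<in> borel_measurable M" and g[measurable]: "g \<in> borel_measurable M"
    and f01: "\<And>x. x \<in> space M \<Longrightarrow> 0 \<le> f x \<and> f x \<le> (1::real)"
    and g01: "\<And>x. x \<in> space M \<Longrightarrow> 0 \<le> g x \<and> g x \<le> (1::real)"
    and hyp: "\<And>a b. 0 \<le> s * (prob ({x\<in>space M. a \<le> f x} \<inter> {x\<in>space M. b \<le> g x}) -
      prob {x\<in>space M. a \<le> f x} * prob {x\<in>space M. b \<le> g x})"
  shows "0 \<le> s * (expectation (\<lambda>x. f x * g x) - expectation f * expectation g)"
proof -
  define U where "U n j = {x\<in>space M. real j / real n \<le> f x}" for n j :: nat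
  define V where "V n j = {x\<in>space M. real j / real n \<le> g x}" for n j :: nat
  have [measurable]: "U n j \<in> events" "V n j \<in> events" for n j
    unfolding U_def V_def by measurable
  define F where "F n x = (\<Sum>j=1..n. indicator (U n j) x) / real n" for n x
  define G where "G n x = (\<Sum>j=1..n. indicator (V n j) x) / real n" for n x
  have F: "F n x = real_of_int \<lfloor>real n * f x\<rfloor> / real n"
    and G: "G n x = real_of_int \<lfloor>real n * g x\<rfloor> / real n" if "x \<in> space M" for n x
    unfolding F_def G_def U_def V_def
    using that f01 g01 by (blast intro: step_function_eq_floor)+
  have le1: "0 \<le> (\<Sum>j=1..n. indicator (W j) x) / real n" "(\<Sum>j=1..n. indicator (W j) x) / real n \<le> 1"
    for n :: nat and x :: 'a and W
  proof -
    have "(\<Sum>j=1..n. indicator (W j) x :: real) \<le> (\<Sum>j=1..n. 1)"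
      by (intro sum_mono) (simp add: indicator_def)
    then show "(\<Sum>j=1..n. indicator (W j) x) / real n \<le> 1" by (simp add: divide_le_eq)
    show "0 \<le> (\<Sum>j=1..n. indicator (W j) x) / real n"
      by (intro divide_nonneg_nonneg sum_nonneg) auto
  qed
  then have F01: "\<bar>F n x\<bar> \<le> 1" and G01: "\<bar>G n x\<bar> \<le> 1" for n x
    unfolding F_def G_def by (auto simp only: abs_of_nonneg)
  have [measurable]: "F n \<in> borel_measurable M" "G n \<in> borel_measurable M" for n
    unfolding F_def G_def by measurable
  have lim: "(\<lambda>n. F n x) \<longlonglongrightarrow> f x" "(\<lambda>n. G n x) \<longlonglongrightarrow> g x" if "x \<in> space M" for x
    using floor_scale_tendsto[of "f x"] floor_scale_tendsto[of "g x"] F[OF that] G[OF that]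
    by simp_all
  have "(\<lambda>n. expectation (F n)) \<longlonglongrightarrow> expectation f"
    by (rule integral_dominated_convergence[where w="\<lambda>_. 1"]) (use lim F01 in auto)
  moreover have "(\<lambda>n. expectation (G n)) \<longlonglongrightarrow> expectation g"
    by (rule integral_dominated_convergence[where w="\<lambda>_. 1"]) (use lim G01 in auto)
  moreover have "(\<lambda>n. expectation (\<lambda>x. F n x * G n x)) \<longlonglongrightarrow> expectation (\<lambda>x. f x * g x)"
    by (rule integral_dominated_convergence[where w="\<lambda>_. 1"])
      (use lim F01 G01 in \<open>auto simp: abs_mult intro!: mult_le_one tendsto_mult\<close>)
  ultimately have "(\<lambda>n. s * (expectation (\<lambda>x. F n x * G n x) - expectation (F n) * expectation (G n)))
    \<longlonglongrightarrow> s * (expectation (\<lambda>x. f x * g x) - expectation f * expectation g)"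
    by (intro tendsto_intros)
  moreover have "0 \<le> s * (expectation (\<lambda>x. F n x * G n x) - expectation (F n) * expectation (G n))" for n
  proof -
    have ind: "integrable M (indicator E :: 'a \<Rightarrow> real)" if "E \<in> events" for E
      using that by (simp add: emeasure_eq_measure)
    have EF: "expectation (F n) = (\<Sum>j=1..n. prob (U n j)) / real n"
      unfolding F_def by (simp add: Bochner_Integration.integral_sum ind)
    have EG: "expectation (G n) = (\<Sum>j=1..n. prob (V n j)) / real n"
      unfolding G_def by (simp add: Bochner_Integration.integral_sum ind)
    have "F n x * G n x = (\<Sum>j=1..n. \<Sum>l=1..n. indicator (U n j \<inter> V n l) x) / (real n * real n)" for x
      unfolding F_def G_def by (simp add: sum_product indicator_inter_arith)
    then have EFG: "expectation (\<lambda>x. F n x * G n x) =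
        (\<Sum>j=1..n. \<Sum>l=1..n. prob (U n j \<inter> V n l)) / (real n * real n)"
      by (simp add: Bochner_Integration.integral_sum ind sets.Int)
    \<comment> \<open>The covariance of the averages is the double average of the covariances of all
      pairs of levels, each of which has the right sign by \<open>hyp\<close>.\<close>
    have "s * (expectation (\<lambda>x. F n x * G n x) - expectation (F n) * expectation (G n)) =
      (\<Sum>j=1..n. \<Sum>l=1..n. s * (prob (U n j \<inter> V n l) - prob (U n j) * prob (V n l))) / (real n * real n)"
      unfolding EF EG EFG
      by (simp add: sum_product sum_subtractf sum_distrib_left[symmetric] diff_divide_distrib[symmetric])
    also have "0 \<le> \<dots>"
      unfolding U_def V_def by (intro divide_nonneg_nonneg sum_nonneg hyp) auto
    finally show ?thesis .
  qed
  ultimately show ?thesis by (intro LIMSEQ_le_const) auto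
qed

text \<open>An increasing affine change brings the values into the unit interval. It only moves the
  thresholds of the level sets and rescales the covariance by a positive factor.\<close>

lemma covariance_sign:
  assumes f[measurable]: "f \<in> borel_measurable M" and g[measurable]: "g \<in> borel_measurable M"
    and fB: "\<And>x. x \<in> space M \<Longrightarrow> \<bar>f x\<bar> \<le> (B::real)"
    and gC: "\<And>x. x \<in> space M \<Longrightarrow> \<bar>g x\<bar> \<le> (C::real)"
    and hyp: "\<And>a b. 0 \<le> s * (prob ({x\<in>space M. a \<le> f x} \<inter> {x\<in>space M. b \<le> g x}) -
      prob {x\<in>space M. a \<le> f x} * prob {x\<in>space M. b \<le> g x})"
  shows "0 \<le> s * (expectation (\<lambda>x. f x * g x) - expectation f * expectation g)"
proof -
  \<comment> \<open>The added 1 keeps the divisor \<open>2 * b\<close> positive even when the bound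
    is 0.\<close>
  define b where "b = \<bar>B\<bar> + 1"
  define c where "c = \<bar>C\<bar> + 1"
  have bc: "0 < b" "0 < c" by (auto simp: b_def c_def)
  have fb: "\<bar>f x\<bar> \<le> b" and gc: "\<bar>g x\<bar> \<le> c" if "x \<in> space M" for x
    using fB[OF that] gC[OF that] by (auto simp: b_def c_def)
  define f' where "f' x = (f x + b) / (2 * b)" for x
  define g' where "g' x = (g x + c) / (2 * c)" for x
  have [measurable]: "f' \<in> borel_measurable M" "g' \<in> borel_measurable M"
    unfolding f'_def g'_def by measurable
  have f'01: "0 \<le> f' x \<and> f' x \<le> 1" and g'01: "0 \<le> g' x \<and> g' x \<le> 1" if "x \<in> space M" for x
    using fb[OF that] gc[OF that] bc by (auto simp: f'_def g'_def divide_le_eq le_divide_eq)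
  have f'_le: "a \<le> f' x \<longleftrightarrow> 2 * b * a - b \<le> f x" and g'_le: "a \<le> g' x \<longleftrightarrow> 2 * c * a - c \<le> g x" for a x
    using bc by (auto simp: f'_def g'_def le_divide_eq algebra_simps)
  have cov': "0 \<le> s * (expectation (\<lambda>x. f' x * g' x) - expectation f' * expectation g')"
  proof (rule covariance_sign_unit)
    show "0 \<le> s * (prob ({x\<in>space M. a \<le> f' x} \<inter> {x\<in>space M. b \<le> g' x}) -
      prob {x\<in>space M. a \<le> f' x} * prob {x\<in>space M. b \<le> g' x})" for a b
      unfolding f'_le g'_le by (rule hyp)
  qed (use f'01 g'01 in auto)
  have int: "integrable M f'" "integrable M g'" "integrable M (\<lambda>x. f' x * g' x)"
    using f'01 g'01
    by (auto intro!: integrable_const_bound[where B=1] AE_I2 mult_le_one simp: abs_mult)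
  have f_eq: "f = (\<lambda>x. 2 * b * f' x - b)" and g_eq: "g = (\<lambda>x. 2 * c * g' x - c)"
    using bc by (auto simp: f'_def g'_def)
  have "expectation f = 2 * b * expectation f' - b" "expectation g = 2 * c * expectation g' - c"
    unfolding f_eq g_eq using int by (simp_all add: prob_space)
  moreover have "f x * g x = 4 * b * c * (f' x * g' x) - 2 * b * c * f' x - 2 * b * c * g' x + b * c" for x
    unfolding f_eq g_eq by (simp add: algebra_simps)
  then have "expectation (\<lambda>x. f x * g x) = 4 * b * c * expectation (\<lambda>x. f' x * g' x) -
      2 * b * c * expectation f' - 2 * b * c * expectation g' + b * c"
    using int by (simp add: prob_space)
  ultimately have "expectation (\<lambda>x. f x * g x) - expectation f * expectation g =
      4 * b * c * (expectation (\<lambda>x. f' x * g' x) - expectation f' * expectation g')"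
    by (simp only:) (simp add: algebra_simps)
  moreover have "0 \<le> 4 * b * c * (s * (expectation (\<lambda>x. f' x * g' x) - expectation f' * expectation g'))"
    by (rule mult_nonneg_nonneg[OF _ cov']) (use bc in simp)
  ultimately show ?thesis by (simp add: mult_ac)
qed

end

section \<open>The coordinatewise preorder and test functions\<close>

text \<open>Placed on the full product rather than on the functions over \<open>J\<close>, so that
  it applies to the laws of whole families. Points agreeing on \<open>J\<close> are then equivalent,
  so antisymmetry is lost when \<open>J\<close> omits coordinates and the order on \<open>'a\<close>
  is reflexive on more than one point.\<close>

definition coord_le :: "('a \<Rightarrow> 'a \<Rightarrow> bool) \<Rightarrow> 'i set \<Rightarrow> (('i \<Rightarrow> 'a) \<times> ('i \<Rightarrow> 'a)) set" where
  "coord_le le J = {(x, y). \<forall>i\<in>J. le (x i) (y i)}"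

lemma coord_le_preorder:
  assumes "pop_space le"
  shows "refl (coord_le le J)" "trans (coord_le le J)"
proof -
  have le: "le x x" "le x y \<Longrightarrow> le y z \<Longrightarrow> le x z" for x y z
    using assms unfolding pop_space_def partial_order_on_def preorder_on_def
    by (auto dest: refl_onD transD)
  show "refl (coord_le le J)" "trans (coord_le le J)"
    by (auto simp: coord_le_def refl_on_def intro: le intro!: transI)
qed

text \<open>Each coordinate constraint is the preimage of the closed order under a continuous map,
  and closedness passes to intersections.\<close>

lemma closed_coord_le:
  fixes le :: "'a::polish_space \<Rightarrow> 'a \<Rightarrow> bool"
  assumes "pop_space le"
  shows "closed (coord_le le J :: (('i::countable \<Rightarrow> 'a) \<times> ('i \<Rightarrow> 'a)) set)"
proof -
  have le: "closed {(x, y). le x y}"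
    using assms by (simp add: pop_space_def)
  have "closed ((\<lambda>p :: ('i \<Rightarrow> 'a) \<times> ('i \<Rightarrow> 'a). (fst p i, snd p i)) -` {(x, y). le x y})" for i
    by (rule closed_vimage[OF le], rule continuous_on_Pair;
        rule continuous_on_compose2[OF continuous_on_product_coordinates];
        simp add: continuous_on_fst continuous_on_snd)
  then have "closed (\<Inter>i\<in>J. (\<lambda>p :: ('i \<Rightarrow> 'a) \<times> ('i \<Rightarrow> 'a). (fst p i, snd p i)) -` {(x, y). le x y})"
    by blast
  also have "(\<Inter>i\<in>J. (\<lambda>p :: ('i \<Rightarrow> 'a) \<times> ('i \<Rightarrow> 'a). (fst p i, snd p i)) -` {(x, y). le x y}) = coord_le le J"
    by (auto simp: coord_le_def)
  finally show ?thesis .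
qed

text \<open>For countably many Polish factors the product sigma-field is the Borel sigma-field of
  the product topology, on which the laws of the families live.\<close>

lemma measurable_restrict_borel:
  "(\<lambda>x. restrict x J) \<in> measurable (borel :: ('i::countable \<Rightarrow> 'a::polish_space) measure) (PiM J (\<lambda>_. borel))"
proof -
  have "(\<lambda>x. restrict x J) \<in> measurable (PiM UNIV (\<lambda>_::'i. borel :: 'a measure)) (PiM J (\<lambda>_. borel))"
    by (rule measurable_restrict_subset) simp
  then show ?thesis
    unfolding measurable_cong_sets[OF sets_PiM_equal_borel refl] .
qed

lemma test_fun_borel:
  fixes f :: "('i::countable \<Rightarrow> 'a::polish_space) \<Rightarrow> real"
  assumes "test_fun le J f"
  shows "(\<lambda>x. f (restrict x J)) \<in> borel_measurable borel"
    and "\<exists>B. \<forall>x. \<bar>f (restrict x J)\<bar> \<le> B"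
    and "coord_le le J `` {x. a \<le> f (restrict x J)} \<subseteq> {x. a \<le> f (restrict x J)}"
proof -
  have sp: "restrict x J \<in> space (PiM J (\<lambda>_. borel))" for x :: "'i \<Rightarrow> 'a"
    by (simp add: space_PiM)
  have meas: "f \<in> borel_measurable (PiM J (\<lambda>_. borel))"
    and bdd: "\<exists>B. \<forall>x\<in>space (PiM J (\<lambda>_. borel)). \<bar>f x\<bar> \<le> B"
    and mono: "nondecreasing_on le J f"
    using assms by (auto simp: test_fun_def)
  show "(\<lambda>x. f (restrict x J)) \<in> borel_measurable borel"
    by (rule measurable_compose[OF measurable_restrict_borel meas])
  show "\<exists>B. \<forall>x. \<bar>f (restrict x J)\<bar> \<le> B" using bdd sp by blast
  have "f (restrict x J) \<le> f (restrict y J)" if "(x, y) \<in> coord_le le J" for x y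
    using mono sp that unfolding nondecreasing_on_def coord_le_def by simp
  then show "coord_le le J `` {x. a \<le> f (restrict x J)} \<subseteq> {x. a \<le> f (restrict x J)}"
    by (auto intro: order_trans)
qed

text \<open>The passage back from the full product to the coordinates in \<open>J\<close>. Points
  agreeing on \<open>J\<close> lie below each other, by reflexivity of \<open>le\<close>, so an
  up-set depends on these coordinates alone and its indicator factors through restriction.\<close>

lemma upset_indicator_test_fun:
  fixes F :: "('i::countable \<Rightarrow> 'a::polish_space) set"
  assumes pop: "pop_space le" and F: "F \<in> sets borel" "coord_le le J `` F \<subseteq> F"
  obtains f where "test_fun le J f" "\<And>x. f (restrict x J) = indicator F x"
proof -
  \<comment> \<open>On extensional functions \<open>ext\<close> is the identity; the explicit case
    distinction shows that each coordinate is either a projection or constant, hence measurable into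
    the full product.\<close>
  define ext where "ext x i = (if i \<in> J then x i else undefined)" for x :: "'i \<Rightarrow> 'a" and i
  define f where "f x = (indicator F (ext x) :: real)" for x
  have le_refl: "le a a" for a
    using coord_le_preorder(1)[OF pop, of UNIV]
    by (auto simp: refl_on_def coord_le_def dest: spec[of _ "\<lambda>_. a"])
  have "ext \<in> measurable (PiM J (\<lambda>_. borel)) (PiM UNIV (\<lambda>_. borel))"
  proof (rule measurable_PiM_single')
    show "(\<lambda>x. ext x i) \<in> measurable (PiM J (\<lambda>_. borel)) borel" for i
      by (cases "i \<in> J") (simp_all add: ext_def)
  qed auto
  then have ext: "ext \<in> measurable (PiM J (\<lambda>_. borel)) borel"
    unfolding measurable_cong_sets[OF refl sets_PiM_equal_borel] .
  have "f \<in> borel_measurable (PiM J (\<lambda>_. borel))"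
    unfolding f_def using F(1) by (intro measurable_compose[OF ext]) simp
  moreover have "nondecreasing_on le J f"
    unfolding nondecreasing_on_def
  proof (intro ballI impI)
    fix x y :: "'i \<Rightarrow> 'a" assume "\<forall>i\<in>J. le (x i) (y i)"
    then have "(ext x, ext y) \<in> coord_le le J" by (simp add: coord_le_def ext_def)
    then show "f x \<le> f y" using F(2) by (auto simp: f_def indicator_def)
  qed
  moreover have "\<exists>B. \<forall>x\<in>space (PiM J (\<lambda>_. borel)). \<bar>f x\<bar> \<le> B"
    by (intro exI[of _ 1]) (simp add: f_def indicator_def)
  moreover have "f (restrict x J) = indicator F x" for x
  proof -
    have "(ext (restrict x J), x) \<in> coord_le le J" "(x, ext (restrict x J)) \<in> coord_le le J"
      by (simp_all add: coord_le_def ext_def le_refl)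
    then show ?thesis using F(2) by (auto simp: f_def indicator_def)
  qed
  ultimately show ?thesis using that by (auto simp: test_fun_def)
qed

section \<open>Transfer to laws and conclusion\<close>

text \<open>A common form of both claims: the hypothesis is specialised to indicators of closed
  up-sets, these give the sign for Borel up-sets under the limit law, and level sets return from
  there to test functions.\<close>

lemma covariance_sign_weak_limit:
  fixes le :: "'a::polish_space \<Rightarrow> 'a \<Rightarrow> bool"
    and Ms :: "nat \<Rightarrow> 'w measure" and Xs :: "nat \<Rightarrow> 'w \<Rightarrow> 'i::countable \<Rightarrow> 'a"
    and M :: "'v measure" and X :: "'v \<Rightarrow> 'i \<Rightarrow> 'a"
  assumes pop: "pop_space le"
    and Ms: "\<And>k. prob_space (Ms k)" and M: "prob_space M"
    and Xs: "\<And>k. random_element (Ms k) (Xs k)" and X: "random_element M X"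
    and conv: "conv_distr Ms Xs M X"
    and s: "\<bar>s\<bar> = 1"
    and hyp: "\<And>k f g. test_fun le J f \<Longrightarrow> test_fun le J' g \<Longrightarrow>
      0 \<le> s * ((\<integral>\<omega>. f (restrict (Xs k \<omega>) J) * g (restrict (Xs k \<omega>) J') \<partial>Ms k) -
        (\<integral>\<omega>. f (restrict (Xs k \<omega>) J) \<partial>Ms k) * (\<integral>\<omega>. g (restrict (Xs k \<omega>) J') \<partial>Ms k))"
    and f: "test_fun le J f" and g: "test_fun le J' g"
  shows "0 \<le> s * ((\<integral>\<omega>. f (restrict (X \<omega>) J) * g (restrict (X \<omega>) J') \<partial>M) -
        (\<integral>\<omega>. f (restrict (X \<omega>) J) \<partial>M) * (\<integral>\<omega>. g (restrict (X \<omega>) J') \<partial>M))"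
proof -
  have Xs': "Xs k \<in> measurable (Ms k) borel" for k
    using Xs[of k] unfolding random_element_def measurable_cong_sets[OF refl sets_PiM_equal_borel] .
  have X': "X \<in> measurable M borel"
    using X unfolding random_element_def measurable_cong_sets[OF refl sets_PiM_equal_borel] .
  \<comment> \<open>The families may live on different probability spaces; their laws are measures
    on one Polish space.\<close>
  define N where "N k = distr (Ms k) borel (Xs k)" for k
  define L where "L = distr M borel X"
  have intN: "(\<integral>x. h x \<partial>N k) = (\<integral>\<omega>. h (Xs k \<omega>) \<partial>Ms k)" if "h \<in> borel_measurable borel" for h :: "_ \<Rightarrow> real" and k
    unfolding N_def by (rule integral_distr[OF Xs' that])
  have intL: "(\<integral>x. h x \<partial>L) = (\<integral>\<omega>. h (X \<omega>) \<partial>M)" if "h \<in> borel_measurable borel" for h :: "_ \<Rightarrow> real"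
    unfolding L_def by (rule integral_distr[OF X' that])
  interpret weak_limit N L
  proof (rule weak_limit.intro)
    show "prob_space (N k)" for k
      unfolding N_def by (rule prob_space.prob_space_distr[OF Ms Xs'])
    show "prob_space L"
      unfolding L_def by (rule prob_space.prob_space_distr[OF M X'])
    show "sets (N k) = sets borel" "sets L = sets borel" for k
      by (simp_all add: N_def L_def)
    fix h :: "('i \<Rightarrow> 'a) \<Rightarrow> real" assume h: "continuous_on UNIV h" "bounded (range h)"
    then have "h \<in> borel_measurable borel" by (intro borel_measurable_continuous_onI)
    then show "(\<lambda>k. \<integral>x. h x \<partial>N k) \<longlonglongrightarrow> (\<integral>x. h x \<partial>L)"
      using conv h unfolding conv_distr_def by (simp add: intN intL)
  qed
  interpret L: prob_space L by (rule prob_L)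
  define f' where "f' x = f (restrict x J)" for x
  define g' where "g' x = g (restrict x J')" for x
  have meas: "f' \<in> borel_measurable borel" "g' \<in> borel_measurable borel"
    unfolding f'_def g'_def using test_fun_borel(1)[OF f] test_fun_borel(1)[OF g] .
  obtain B where B: "\<And>x. \<bar>f' x\<bar> \<le> B" unfolding f'_def using test_fun_borel(2)[OF f] by blast
  obtain C where C: "\<And>x. \<bar>g' x\<bar> \<le> C" unfolding g'_def using test_fun_borel(2)[OF g] by blast
  \<comment> \<open>Indicators of closed up-sets come from test functions, so association of the
    approximating families yields the set inequality needed for
    \<open>covariance_sign_upsets\<close>.\<close>
  have closed_sets: "0 \<le> s * (measure (N k) (F \<inter> G) - measure (N k) F * measure (N k) G)"
    if F: "closed F" "coord_le le J `` F \<subseteq> F" and G: "closed G" "coord_le le J' `` G \<subseteq> G" for k F G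
  proof -
    have FG: "F \<in> sets borel" "G \<in> sets borel" using F G by auto
    obtain p where p: "test_fun le J p" "\<And>x. p (restrict x J) = indicator F x"
      using upset_indicator_test_fun[OF pop FG(1) F(2)] by blast
    obtain q where q: "test_fun le J' q" "\<And>x. q (restrict x J') = indicator G x"
      using upset_indicator_test_fun[OF pop FG(2) G(2)] by blast
    have ind: "(\<integral>\<omega>. indicator E (Xs k \<omega>) \<partial>Ms k) = measure (N k) E" if "E \<in> sets borel" for E
      using intN[of "indicator E" k] that by simp
    show ?thesis
      using hyp[OF p(1) q(1), of k] ind FG
      unfolding p(2) q(2) indicator_inter_arith[symmetric] by (simp add: sets.Int)
  qed
  have "0 \<le> s * ((\<integral>x. f' x * g' x \<partial>L) - (\<integral>x. f' x \<partial>L) * (\<integral>x. g' x \<partial>L))"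
  proof (rule L.covariance_sign[OF _ _ B C])
    show "f' \<in> borel_measurable L" "g' \<in> borel_measurable L"
      using meas by (simp_all add: measurable_cong_sets[OF sets_L refl])
    fix a b
    have sets: "{x. a \<le> f' x} \<in> sets borel" "{x. b \<le> g' x} \<in> sets borel"
      using meas unfolding borel_measurable_iff_ge by simp_all
    have up: "coord_le le J `` {x. a \<le> f' x} \<subseteq> {x. a \<le> f' x}"
      "coord_le le J' `` {x. b \<le> g' x} \<subseteq> {x. b \<le> g' x}"
      unfolding f'_def g'_def by (rule test_fun_borel(3)[OF f], rule test_fun_borel(3)[OF g])
    show "0 \<le> s * (measure L ({x \<in> space L. a \<le> f' x} \<inter> {x \<in> space L. b \<le> g' x}) -
        measure L {x \<in> space L. a \<le> f' x} * measure L {x \<in> space L. b \<le> g' x})"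
      using covariance_sign_upsets[OF closed_coord_le[OF pop] coord_le_preorder[OF pop]
          closed_coord_le[OF pop] coord_le_preorder[OF pop] s closed_sets sets(1) up(1) sets(2) up(2)]
      by simp
  qed
  then show ?thesis
    using meas by (simp add: intL) (simp add: f'_def g'_def)
qed

theorem theorem3p6:
  fixes le :: "'a::polish_space \<Rightarrow> 'a \<Rightarrow> bool"
    and Ms :: "nat \<Rightarrow> 'w measure" and Xs :: "nat \<Rightarrow> 'w \<Rightarrow> 'i::countable \<Rightarrow> 'a"
    and M :: "'v measure" and X :: "'v \<Rightarrow> 'i \<Rightarrow> 'a"
  assumes "pop_space le"
    and "\<And>k. prob_space (Ms k)" and "prob_space M"
    and "\<And>k. random_element (Ms k) (Xs k)" and "random_element M X"
    and "conv_distr Ms Xs M X"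
  shows "((\<forall>k. neg_assoc (Ms k) le (Xs k)) \<longrightarrow> neg_assoc M le X)
       \<and> ((\<forall>k. pos_assoc (Ms k) le (Xs k)) \<longrightarrow> pos_assoc M le X)"
proof (intro conjI impI)
  assume na: "\<forall>k. neg_assoc (Ms k) le (Xs k)"
  show "neg_assoc M le X"
    unfolding neg_assoc_def
  proof (intro allI impI, elim conjE)
    fix J :: "'i set" and f g assume fg: "test_fun le J f" "test_fun le (UNIV - J) g"
    \<comment> \<open>Negative association is the sign \<open>- 1\<close> with complementary
      coordinate sets.\<close>
    have "0 \<le> - 1 * ((\<integral>\<omega>. f (restrict (X \<omega>) J) * g (restrict (X \<omega>) (UNIV - J)) \<partial>M) -
        (\<integral>\<omega>. f (restrict (X \<omega>) J) \<partial>M) * (\<integral>\<omega>. g (restrict (X \<omega>) (UNIV - J)) \<partial>M))"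
    proof (rule covariance_sign_weak_limit[OF assms _ _ fg])
      fix k f g assume "test_fun le J f" "test_fun le (UNIV - J) g"
      then have "(\<integral>\<omega>. f (restrict (Xs k \<omega>) J) * g (restrict (Xs k \<omega>) (UNIV - J)) \<partial>Ms k)
          \<le> (\<integral>\<omega>. f (restrict (Xs k \<omega>) J) \<partial>Ms k) * (\<integral>\<omega>. g (restrict (Xs k \<omega>) (UNIV - J)) \<partial>Ms k)"
        by (intro na[rule_format, of k, unfolded neg_assoc_def, rule_format, OF conjI])
      then show "0 \<le> - 1 * ((\<integral>\<omega>. f (restrict (Xs k \<omega>) J) * g (restrict (Xs k \<omega>) (UNIV - J)) \<partial>Ms k)
          - (\<integral>\<omega>. f (restrict (Xs k \<omega>) J) \<partial>Ms k) * (\<integral>\<omega>. g (restrict (Xs k \<omega>) (UNIV - J)) \<partial>Ms k))"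
        by simp
    qed simp
    then show "(\<integral>\<omega>. f (restrict (X \<omega>) J) * g (restrict (X \<omega>) (UNIV - J)) \<partial>M)
          \<le> (\<integral>\<omega>. f (restrict (X \<omega>) J) \<partial>M) * (\<integral>\<omega>. g (restrict (X \<omega>) (UNIV - J)) \<partial>M)"
      by simp
  qed
next
  assume pa: "\<forall>k. pos_assoc (Ms k) le (Xs k)"
  show "pos_assoc M le X"
    unfolding pos_assoc_def
  proof (intro allI impI, elim conjE)
    fix J :: "'i set" and f g assume fg: "test_fun le J f" "test_fun le J g"
    \<comment> \<open>Positive association is the sign \<open>1\<close> with the same coordinate set
      twice.\<close>
    have "0 \<le> 1 * ((\<integral>\<omega>. f (restrict (X \<omega>) J) * g (restrict (X \<omega>) J) \<partial>M) -
        (\<integral>\<omega>. f (restrict (X \<omega>) J) \<partial>M) * (\<integral>\<omega>. g (restrict (X \<omega>) J) \<partial>M))"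
    proof (rule covariance_sign_weak_limit[OF assms _ _ fg])
      fix k f g assume "test_fun le J f" "test_fun le J g"
      then have "(\<integral>\<omega>. f (restrict (Xs k \<omega>) J) * g (restrict (Xs k \<omega>) J) \<partial>Ms k)
          \<ge> (\<integral>\<omega>. f (restrict (Xs k \<omega>) J) \<partial>Ms k) * (\<integral>\<omega>. g (restrict (Xs k \<omega>) J) \<partial>Ms k)"
        by (intro pa[rule_format, of k, unfolded pos_assoc_def, rule_format, OF conjI])
      then show "0 \<le> 1 * ((\<integral>\<omega>. f (restrict (Xs k \<omega>) J) * g (restrict (Xs k \<omega>) J) \<partial>Ms k)
          - (\<integral>\<omega>. f (restrict (Xs k \<omega>) J) \<partial>Ms k) * (\<integral>\<omega>. g (restrict (Xs k \<omega>) J) \<partial>Ms k))"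
        by simp
    qed simp
    then show "(\<integral>\<omega>. f (restrict (X \<omega>) J) * g (restrict (X \<omega>) J) \<partial>M)
          \<ge> (\<integral>\<omega>. f (restrict (X \<omega>) J) \<partial>M) * (\<integral>\<omega>. g (restrict (X \<omega>) J) \<partial>M)"
      by simp
  qed
qed

end
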